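(* For $n\ge1$ let $c^n_{x,y}$ be the conductances of the set consisting of the bottom row $x_0,\dots,x_{2^n}$ of $V_n$ together with the top point $q_0$, and write $c^n_{i,j}=c^n_{x_i,x_j}$ (where $x_i$ is the $i$-th point of the bottom row of $V_n$). Then for $n\ge1$ and $0<i<j<2^n$, $$c^{n+1}_{i,j}=\frac53\,c^n_{i,j}+\frac{196\cdot25^{n+1}(10\cdot3^{n+1}+39\cdot10^{n+1})}{(3^{n+1}+6\cdot10^{n+1})(5\cdot3^{n+1}+16\cdot10^{n+1})(5\cdot3^{n+1}+9\cdot10^{n+1})}.$$
   Context: Let $q_0,q_1,q_2$ be the vertices of an equilateral triangle in the plane, $F_i(x)=\frac12(x+q_i)$, and let $SG$ (the Sierpinski gasket) be the unique nonempty compact set with $SG=\bigcup_{i}F_i(SG)$. For a word $w$ of length $m$ let $F_w=F_{w_1}\circ\cdots\circ F_{w_m}$. Put $V_0=\{q_0,q_1,q_2\}$, $V_m=\bigcup_iF_iV_{m-1}$; $x\sim_m y$ means $x\ne y$ and $x,y\in F_wV_0$ for some word $w$ of length $m$. The bottom row of $V_n$ consists of the points $x_i=q_1+\frac{i}{2^n}(q_2-q_1)$, $0\le i\le2^n$ (so $x_i$ depends on $n$; $c^{n+1}_{i,j}$ refers to the points of the bottom row of $V_{n+1}$). The energy of a continuous $u:SG\to\mathbb{R}$ is $\mathcal{E}(u)=\lim_{m\to\infty}\left(\frac53\right)^m\sum_{\{x,y\}:x\sim_m y}(u(x)-u(y))^2$ (a nondecreasing limit), and $\operatorname{dom}\mathcal{E}$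 is the set of continuous $u$ with $\mathcal{E}(u)<\infty$. For a nonempty set $A\subset V_n$ and values prescribed on $A$, there is a unique $u\in\operatorname{dom}\mathcal{E}$ of least energy with these values on $A$, and its energy has the form $\mathcal{E}(u)=\sum_{\{x,y\}\subset A}c_{x,y}(u(x)-u(y))^2$; the (uniquely determined, symmetric) coefficients $c_{x,y}$, $x\neq y$, are the conductances of $A$. *)

theory Defs
  imports "HOL-Analysis.Analysis"
begin

(* The three vertices are q 0, q 1, q 2; the values q i for i >= 3 play no role. *)

definition equilateral :: "(nat \<Rightarrow> real^2) \<Rightarrow> bool" where
  "equilateral q \<longleftrightarrow> q 0 \<noteq> q 1 \<and> dist (q 0) (q 1) = dist (q 1) (q 2)
     \<and> dist (q 1) (q 2) = dist (q 2) (q 0)"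

definition sg_map :: "(nat \<Rightarrow> real^2) \<Rightarrow> nat \<Rightarrow> real^2 \<Rightarrow> real^2" where
  "sg_map q i x = (1/2) *\<^sub>R (x + q i)"

definition SG :: "(nat \<Rightarrow> real^2) \<Rightarrow> (real^2) set" where
  "SG q = (THE K. compact K \<and> K \<noteq> {} \<and> K = (\<Union>i<3. sg_map q i ` K))"

primrec word_map :: "(nat \<Rightarrow> real^2) \<Rightarrow> nat list \<Rightarrow> real^2 \<Rightarrow> real^2" where
  "word_map q [] = id"
| "word_map q (i # w) = sg_map q i \<circ> word_map q w"

primrec V :: "(nat \<Rightarrow> real^2) \<Rightarrow> nat \<Rightarrow> (real^2) set" where
  "V q 0 = q ` {..<3}"
| "V q (Suc m) = (\<Union>i<3. sg_map q i ` V q m)"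

definition adj :: "(nat \<Rightarrow> real^2) \<Rightarrow> nat \<Rightarrow> real^2 \<Rightarrow> real^2 \<Rightarrow> bool" where
  "adj q m x y \<longleftrightarrow> x \<noteq> y \<and>
     (\<exists>w. length w = m \<and> set w \<subseteq> {..<3} \<and>
        x \<in> word_map q w ` V q 0 \<and> y \<in> word_map q w ` V q 0)"

(* The sum over unordered pairs is half the sum over ordered pairs. *)
definition level_energy :: "(nat \<Rightarrow> real^2) \<Rightarrow> nat \<Rightarrow> (real^2 \<Rightarrow> real) \<Rightarrow> real" where
  "level_energy q m u = (5/3)^m * ((\<Sum>(x,y) | adj q m x y. (u x - u y)^2) / 2)"

definition energy :: "(nat \<Rightarrow> real^2) \<Rightarrow> (real^2 \<Rightarrow> real) \<Rightarrow> ereal" where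
  "energy q u = lim (\<lambda>m. ereal (level_energy q m u))"

(* Functions on the gasket are represented by total functions on the plane, of which only
   the restriction to SG q matters. *)
definition dom_energy :: "(nat \<Rightarrow> real^2) \<Rightarrow> (real^2 \<Rightarrow> real) set" where
  "dom_energy q = {u. continuous_on (SG q) u \<and> energy q u < \<infinity>}"

definition least_energy_ext ::
    "(nat \<Rightarrow> real^2) \<Rightarrow> (real^2) set \<Rightarrow> (real^2 \<Rightarrow> real) \<Rightarrow> (real^2 \<Rightarrow> real) \<Rightarrow> bool" where
  "least_energy_ext q A f u \<longleftrightarrow>
     u \<in> dom_energy q \<and> (\<forall>x\<in>A. u x = f x) \<and>
     (\<forall>v\<in>dom_energy q. (\<forall>x\<in>A. v x = f x) \<longrightarrow> energy q u \<le> energy q v)"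

(* Only the values at pairs of distinct points of A are meaningful; requiring the others to
   vanish makes the coefficient function unique.  The factor 1/2 again turns ordered into
   unordered pairs. *)
definition conductance ::
    "(nat \<Rightarrow> real^2) \<Rightarrow> (real^2) set \<Rightarrow> real^2 \<Rightarrow> real^2 \<Rightarrow> real" where
  "conductance q A = (THE c.
     (\<forall>x y. c x y = c y x) \<and>
     (\<forall>x y. x = y \<or> x \<notin> A \<or> y \<notin> A \<longrightarrow> c x y = 0) \<and>
     (\<forall>f u. least_energy_ext q A f u \<longrightarrow>
        energy q u = ereal ((\<Sum>x\<in>A. \<Sum>y\<in>A. c x y * (u x - u y)^2) / 2)))"

definition bottom_pt :: "(nat \<Rightarrow> real^2) \<Rightarrow> nat \<Rightarrow> nat \<Rightarrow> real^2" where
  "bottom_pt q n i = q 1 + (real i / 2^n) *\<^sub>R (q 2 - q 1)"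

definition bottom_row_with_top :: "(nat \<Rightarrow> real^2) \<Rightarrow> nat \<Rightarrow> (real^2) set" where
  "bottom_row_with_top q n = insert (q 0) (bottom_pt q n ` {..2^n})"

definition row_conductance :: "(nat \<Rightarrow> real^2) \<Rightarrow> nat \<Rightarrow> nat \<Rightarrow> nat \<Rightarrow> real" where
  "row_conductance q n i j =
     conductance q (bottom_row_with_top q n) (bottom_pt q n i) (bottom_pt q n j)"

end

(*
  The left and right cells F_1 SG and F_2 SG carry copies of the network on level n, scaled by 5/3,
  and the top cell contributes a triangle with conductances 5/3.  Eliminating the two points F_1 q_0
  and F_2 q_0 turns these into the network on level n + 1, so for two interior points of the left half
  the conductance changes from c to 5/3 * (c + t^2 * (T + 2) / ((T + 1) * (T + 3))), where t is the
  conductance from q_0 to an interior point of the row and T is the sum of all conductances at q_0.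
  The same elimination gives T' = 10/3 * T / (T + 1), which is solved explicitly.

  Minimisers exist because functions on the three cells that agree at the three junction points can be
  glued.  This reduces the problem to harmonic functions with given values on V_0, which are uniform
  limits of iterated gluings since the 1/5--2/5 rule contracts oscillation by 3/5.
*)

theory Submission
  imports Defs
begin

section \<open>The gasket\<close>

lemma sg_map_dist: "dist (sg_map q i x) (sg_map q i y) = dist x y / 2"
  by (simp add: sg_map_def dist_norm flip: scaleR_diff_right)

lemma sg_map_inj: "sg_map q i x = sg_map q i y \<longleftrightarrow> x = y"
  by (simp add: sg_map_def)

lemma sg_map_vertex: "sg_map q i (q i) = q i"
  by (simp add: sg_map_def flip: scaleR_2)

lemma sg_map_commute: "sg_map q i (q j) = sg_map q j (q i)"
  by (simp add: sg_map_def add.commute)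

lemma continuous_sg_map: "continuous_on A (sg_map q i)"
  unfolding sg_map_def by (intro continuous_intros)

text \<open>The point of \<open>K\<close> farthest from \<open>L\<close> is the image of a point of
  \<open>K\<close>, and the maps halve distances while preserving \<open>L\<close>, so the maximal
  distance is at most half of itself. Since only inclusions are assumed, this yields uniqueness of
  the attractor as well as inner and outer bounds for it.\<close>

lemma attractor_subset:
  assumes K: "compact K" "K \<subseteq> (\<Union>i<3. sg_map q i ` K)"
    and L: "compact L" "L \<noteq> {}" "(\<Union>i<3. sg_map q i ` L) \<subseteq> L"
  shows "K \<subseteq> L"
proof (cases "K = {}")
  case False
  have "continuous_on K (\<lambda>x. infdist x L)" by (intro continuous_intros)
  then obtain x where x: "x \<in> K" "\<And>y. y \<in> K \<Longrightarrow> infdist y L \<le> infdist x L"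
    using continuous_attains_sup[OF K(1) False] by blast
  from x(1) K(2) obtain i y where y: "i < 3" "y \<in> K" "x = sg_map q i y" by blast
  obtain z where z: "z \<in> L" "infdist y L = dist y z"
    using infdist_attains_inf[OF compact_imp_closed[OF L(1)] L(2)] by blast
  have "sg_map q i z \<in> L" using z(1) y(1) L(3) by blast
  then have "infdist x L \<le> dist y z / 2"
    using infdist_le[of "sg_map q i z" L x] y(3) sg_map_dist[of q i y z] by simp
  also have "\<dots> \<le> infdist x L / 2" using x(2)[OF y(2)] z(2) by simp
  finally have "infdist x L \<le> 0" by simp
  then have "infdist y L = 0" if "y \<in> K" for y
    using x(2)[OF that] infdist_nonneg[of y L] by linarith
  then show ?thesis
    using in_closed_iff_infdist_zero[OF compact_imp_closed[OF L(1)] L(2)] by blast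
qed auto

lemma vertex_in_V: "i < 3 \<Longrightarrow> q i \<in> V q m"
proof (induction m)
  case (Suc m)
  then have "sg_map q i (q i) \<in> V q (Suc m)" by auto
  then show ?case by (simp only: sg_map_vertex)
qed auto

lemma sg_map_hull:
  assumes "i < 3" "x \<in> convex hull (q ` {..<3})"
  shows "sg_map q i x \<in> convex hull (q ` {..<3})"
proof -
  have "q i \<in> convex hull (q ` {..<3})" using assms(1) by (simp add: hull_inc)
  from convexD[OF convex_convex_hull assms(2) this, of "1/2" "1/2"]
  show ?thesis by (simp add: sg_map_def scaleR_add_right)
qed

lemma V_subset_hull: "V q m \<subseteq> convex hull (q ` {..<3})"
  by (induction m) (auto simp: hull_inc sg_map_hull)

lemma V_mono: "V q m \<subseteq> V q (Suc m)"
proof (induction m)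
  case 0
  then show ?case using vertex_in_V[of _ q "Suc 0"] by auto
next
  case (Suc m)
  then have "(\<Union>i<3. sg_map q i ` V q m) \<subseteq> (\<Union>i<3. sg_map q i ` V q (Suc m))"
    by (intro UN_mono image_mono order_refl)
  then show ?case by (simp only: V.simps(2)[symmetric])
qed

lemma finite_V: "finite (V q m)"
  by (induction m) auto

text \<open>The closure of the union of all \<open>V q m\<close> is an attractor;
  \<open>attractor_subset\<close> in both directions makes it the only one.\<close>

lemma attractor_ex1:
  "\<exists>!K. compact K \<and> K \<noteq> {} \<and> K = (\<Union>i<3. sg_map q i ` K)"
proof (rule ex_ex1I)
  let ?W = "\<Union>m. V q m"
  have bdd: "bounded ?W"
    by (rule bounded_subset[of "convex hull (q ` {..<3})"])
      (use V_subset_hull in \<open>auto intro!: compact_imp_bounded finite_imp_compact_convex_hull\<close>)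
  have W: "?W = (\<Union>i<3. sg_map q i ` ?W)"
  proof
    have "V q m \<subseteq> (\<Union>i<3. sg_map q i ` ?W)" for m
      using V_mono[of q m] unfolding V.simps(2) by blast
    then show "?W \<subseteq> (\<Union>i<3. sg_map q i ` ?W)" by blast
    have "sg_map q i ` V q m \<subseteq> V q (Suc m)" if "i < 3" for i m using that by auto
    then show "(\<Union>i<3. sg_map q i ` ?W) \<subseteq> ?W" by blast
  qed
  \<comment> \<open>Each map is a scaling followed by a translation, and both commute with
    closure.\<close>
  have cl: "sg_map q i ` closure ?W = closure (sg_map q i ` ?W)" for i
  proof -
    have "sg_map q i ` S = (\<lambda>x. (1/2) *\<^sub>R q i + x) ` ((*\<^sub>R) (1/2) ` S)" for S
      by (auto simp: sg_map_def image_image scaleR_add_right add.commute)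
    then show ?thesis by (simp add: closure_translation closure_scaleR)
  qed
  have "closure ?W = (\<Union>i<3. closure (sg_map q i ` ?W))"
  proof -
    have "closure ?W = closure (\<Union>i<3. sg_map q i ` ?W)" using W by (rule arg_cong)
    also have "\<dots> = (\<Union>i<3. closure (sg_map q i ` ?W))"
      by (simp add: eval_nat_numeral lessThan_Suc closure_Un Un_ac)
    finally show ?thesis .
  qed
  moreover have "q 0 \<in> ?W" by (rule UN_I[of 0]) auto
  then have "?W \<noteq> {}" by (simp only: ex_in_conv[symmetric]) (rule exI)
  moreover have "compact (closure ?W)" using bdd by (simp only: compact_closure)
  ultimately show "\<exists>K. compact K \<and> K \<noteq> {} \<and> K = (\<Union>i<3. sg_map q i ` K)"
    unfolding cl[symmetric] by (metis closure_eq_empty)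
next
  fix K L
  assume "compact K \<and> K \<noteq> {} \<and> K = (\<Union>i<3. sg_map q i ` K)"
    and "compact L \<and> L \<noteq> {} \<and> L = (\<Union>i<3. sg_map q i ` L)"
  then show "K = L"
    by (elim conjE, intro equalityI)
      (rule attractor_subset[OF _ equalityD1 _ _ equalityD2], assumption+)+
qed

lemma SG_attractor: "compact (SG q) \<and> SG q \<noteq> {} \<and> SG q = (\<Union>i<3. sg_map q i ` SG q)"
  unfolding SG_def by (rule theI'[OF attractor_ex1])

lemma compact_SG: "compact (SG q)" and SG_nonempty: "SG q \<noteq> {}"
  and SG_eq: "SG q = (\<Union>i<3. sg_map q i ` SG q)"
  by (rule SG_attractor[THEN conjunct1], rule SG_attractor[THEN conjunct2, THEN conjunct1],
      rule SG_attractor[THEN conjunct2, THEN conjunct2])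

lemma sg_map_in_SG: "i < 3 \<Longrightarrow> x \<in> SG q \<Longrightarrow> sg_map q i x \<in> SG q"
  by (subst SG_eq) auto

lemma SG_cases:
  assumes "x \<in> SG q"
  obtains i y where "i < 3" "y \<in> SG q" "x = sg_map q i y"
proof -
  have "x \<in> (\<Union>i<3. sg_map q i ` SG q)" using assms SG_eq by simp
  with that show ?thesis by blast
qed

lemma vertex_in_SG:
  assumes "i < 3" shows "q i \<in> SG q"
proof -
  have "{q i} \<subseteq> (\<Union>j<3. sg_map q j ` {q i})"
    using assms sg_map_vertex[of q i] by force
  then have "{q i} \<subseteq> SG q"
    by (rule attractor_subset[OF compact_sing _ compact_SG SG_nonempty equalityD2[OF SG_eq]])
  then show ?thesis by simp
qed

lemma V_subset_SG: "V q m \<subseteq> SG q"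
  by (induction m) (auto intro: sg_map_in_SG vertex_in_SG)

lemma SG_subset_hull: "SG q \<subseteq> convex hull (q ` {..<3})"
proof (rule attractor_subset[OF compact_SG equalityD1[OF SG_eq]])
  show "compact (convex hull (q ` {..<3}))" by (simp add: finite_imp_compact_convex_hull)
  show "convex hull (q ` {..<3}) \<noteq> {}" using hull_inc[of "q 0" "q ` {..<3}" convex] by auto
  show "(\<Union>i<3. sg_map q i ` (convex hull (q ` {..<3}))) \<subseteq> convex hull (q ` {..<3})"
    by (auto simp: sg_map_hull)
qed

section \<open>Cells of an equilateral triangle\<close>

locale equilateral_triangle =
  fixes q :: "nat \<Rightarrow> real^2"
  assumes equilateral: "equilateral q"
begin

abbreviation "s \<equiv> dist (q 0) (q 1)"

lemma s_pos: "s > 0"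
  using equilateral unfolding equilateral_def by (metis zero_less_dist_iff)

lemma less_3: "i < 3 \<longleftrightarrow> i = 0 \<or> i = 1 \<or> i = (2::nat)"
  by auto

lemma dist_vertices: "i < 3 \<Longrightarrow> j < 3 \<Longrightarrow> i \<noteq> j \<Longrightarrow> dist (q i) (q j) = s"
  using equilateral unfolding equilateral_def less_3 by (auto simp: dist_commute)

lemma vertex_eq_iff: "i < 3 \<Longrightarrow> j < 3 \<Longrightarrow> q i = q j \<longleftrightarrow> i = j"
  using dist_vertices[of i j] s_pos by (cases "i = j") auto

text \<open>On the triangle the linear functional with direction \<open>q j - q i\<close> is maximal
  at \<open>q j\<close> alone: it drops by \<open>s^2\<close> towards \<open>q i\<close> and, by the
  60 degree angle, by \<open>s^2 / 2\<close> towards the third vertex.\<close>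

lemma vertex_extreme:
  assumes ij: "i < 3" "j < 3" "i \<noteq> j" and x: "x \<in> SG q"
  shows "(x - q j) \<bullet> (q j - q i) \<le> 0"
    and "(x - q j) \<bullet> (q j - q i) = 0 \<Longrightarrow> x = q j"
proof -
  \<comment> \<open>The three indices add up to 3, so the third one is
    \<open>3 - i - j\<close>.\<close>
  obtain k where k: "k < 3" "k \<noteq> i" "k \<noteq> j"
  proof
    show "3 - i - j < 3" "3 - i - j \<noteq> i" "3 - i - j \<noteq> j"
      using ij unfolding less_3 by auto
  qed
  have "q ` {..<3} = {q i, q j, q k}"
    using ij k unfolding less_3 by (auto simp: lessThan_nat_numeral lessThan_Suc numeral_eq_Suc)
  then have "x \<in> convex hull {q i, q j, q k}" using x SG_subset_hull[of q] by auto
  then obtain a b c where abc: "0 \<le> a" "0 \<le> b" "0 \<le> c" "a + b + c = 1"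
      "x = a *\<^sub>R q i + b *\<^sub>R q j + c *\<^sub>R q k"
    unfolding convex_hull_3 by auto
  have sq: "(q j - q i) \<bullet> (q j - q i) = s^2" "(q k - q j) \<bullet> (q k - q j) = s^2"
    "(q k - q i) \<bullet> (q k - q i) = s^2"
    using dist_vertices[of j i] dist_vertices[of k j] dist_vertices[of k i] ij k
    by (simp_all add: dist_norm power2_norm_eq_inner flip: power2_norm_eq_inner)
  have b: "b = 1 - a - c" using abc by simp
  have xq: "x - q j = c *\<^sub>R (q k - q j) - a *\<^sub>R (q j - q i)"
    by (simp add: abc(5) b algebra_simps)
  have "(q k - q i) \<bullet> (q k - q i) = (q k - q j) \<bullet> (q k - q j)
      + 2 * ((q k - q j) \<bullet> (q j - q i)) + (q j - q i) \<bullet> (q j - q i)"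
    by (simp add: inner_diff_left inner_diff_right inner_commute algebra_simps)
  then have kj: "(q k - q j) \<bullet> (q j - q i) = - (s^2 / 2)" unfolding sq by simp
  have *: "(x - q j) \<bullet> (q j - q i) = - (c / 2 + a) * s^2"
    unfolding xq inner_diff_left[of "c *\<^sub>R _"] inner_scaleR_left sq kj by (simp add: algebra_simps)
  then show "(x - q j) \<bullet> (q j - q i) \<le> 0"
    unfolding * using abc by (intro mult_nonpos_nonneg) auto
  assume "(x - q j) \<bullet> (q j - q i) = 0"
  then have "c / 2 + a = 0" using * s_pos by simp
  then have "c = 0" "a = 0" using abc by auto
  then show "x = q j" using xq by simp
qed

text \<open>Equal images mean \<open>x - q j = y - q i\<close>. Extremality of \<open>q j\<close>
  and of \<open>q i\<close> bounds the same inner product from both sides, so it is zero. Distinct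
  cells thus meet only in the image of a vertex.\<close>

lemma cells_meet:
  assumes ij: "i < 3" "j < 3" "i \<noteq> j" and x: "x \<in> SG q" and y: "y \<in> SG q"
    and eq: "sg_map q i x = sg_map q j y"
  shows "x = q j" "y = q i"
proof -
  have e: "y = x + q i - q j" using eq by (simp add: sg_map_def eq_diff_eq)
  have "(x - q j) \<bullet> (q j - q i) \<le> 0" using vertex_extreme(1)[OF ij x] .
  moreover have "(y - q i) \<bullet> (q i - q j) \<le> 0" using vertex_extreme(1)[OF ij(2,1) ij(3)[symmetric] y] .
  then have "(x - q j) \<bullet> (q i - q j) \<le> 0" using e by simp
  then have "(x - q j) \<bullet> (q j - q i) \<ge> 0" by (simp add: inner_diff_right)
  ultimately show "x = q j" using vertex_extreme(2)[OF ij x] by simp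
  then show "y = q i" using e by simp
qed

section \<open>Points of the bottom row\<close>

lemma bottom_pt_eq_iff: "bottom_pt q n i = bottom_pt q n j \<longleftrightarrow> i = j"
  using vertex_eq_iff[of 1 2] by (auto simp: bottom_pt_def)

lemma bottom_pt_neq_top: "bottom_pt q n i \<noteq> q 0"
proof
  define r where "r = real i / 2^n"
  assume "bottom_pt q n i = q 0"
  then have e: "q 0 = q 1 + r *\<^sub>R (q 2 - q 1)" by (simp add: bottom_pt_def r_def)
  have "q 0 - q 2 = (r - 1) *\<^sub>R (q 2 - q 1)" "q 0 - q 1 = r *\<^sub>R (q 2 - q 1)"
    by (simp_all add: e algebra_simps)
  then have "dist (q 0) (q 2) = \<bar>r - 1\<bar> * dist (q 2) (q 1)"
     "dist (q 0) (q 1) = \<bar>r\<bar> * dist (q 2) (q 1)"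
    by (simp_all add: dist_norm)
  then have "\<bar>r - 1\<bar> = 1" "\<bar>r\<bar> = 1"
    using dist_vertices[of 0 2] dist_vertices[of 2 1] s_pos by auto
  then show False by (auto simp: abs_if split: if_splits)
qed

lemma sg_map_bottom_pt:
  "sg_map q 1 (bottom_pt q n i) = bottom_pt q (Suc n) i"
  "sg_map q 2 (bottom_pt q n i) = bottom_pt q (Suc n) (2^n + i)"
  by (auto simp: sg_map_def bottom_pt_def vec_eq_iff field_simps)

lemma bottom_pt_ends: "bottom_pt q n 0 = q 1" "bottom_pt q n (2^n) = q 2"
  by (auto simp: bottom_pt_def)

lemma bottom_pt_in_SG: "i \<le> 2^n \<Longrightarrow> bottom_pt q n i \<in> SG q"
proof (induction n arbitrary: i)
  case 0
  then have "i = 0 \<or> i = 1" by auto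
  then show ?case using bottom_pt_ends[of 0] vertex_in_SG[of 1] vertex_in_SG[of 2] by auto
next
  case (Suc n)
  show ?case
  proof (cases "i \<le> 2^n")
    case True
    then show ?thesis
      using sg_map_in_SG[OF _ Suc.IH[OF True], of 1] by (simp add: sg_map_bottom_pt flip: One_nat_def)
  next
    case False
    then show ?thesis
      using sg_map_in_SG[OF _ Suc.IH[of "i - 2^n"], of 2] Suc.prems by (simp add: sg_map_bottom_pt)
  qed
qed

section \<open>Energy\<close>

lemma word_map_subset_V: "set w \<subseteq> {..<3} \<Longrightarrow> word_map q w ` V q 0 \<subseteq> V q (length w)"
  by (induction w) (auto simp del: V.simps(1))

lemma adj_imp_V: "adj q m x y \<Longrightarrow> x \<in> V q m \<and> y \<in> V q m"
  unfolding adj_def using word_map_subset_V by blast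

lemma finite_adj: "finite {(x, y). adj q m x y}"
  by (rule finite_subset[of _ "V q m \<times> V q m"]) (auto simp: finite_V dest: adj_imp_V)

lemma adj_Suc: "adj q (Suc m) x y \<longleftrightarrow>
  (\<exists>i<3. \<exists>x' y'. x = sg_map q i x' \<and> y = sg_map q i y' \<and> adj q m x' y')"
proof
  assume "adj q (Suc m) x y"
  then obtain w where w: "x \<noteq> y" "length w = Suc m" "set w \<subseteq> {..<3}"
      "x \<in> word_map q w ` V q 0" "y \<in> word_map q w ` V q 0"
    unfolding adj_def by blast
  then obtain i v where "w = i # v" by (cases w) auto
  with w obtain a b where ab: "i < 3" "a \<in> word_map q v ` V q 0" "b \<in> word_map q v ` V q 0"
      "x = sg_map q i a" "y = sg_map q i b" "length v = m" "set v \<subseteq> {..<3}"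
    by (auto simp del: V.simps)
  then have "adj q m a b" using w(1) unfolding adj_def by blast
  with ab show "\<exists>i<3. \<exists>x' y'. x = sg_map q i x' \<and> y = sg_map q i y' \<and> adj q m x' y'"
    by blast
next
  assume "\<exists>i<3. \<exists>x' y'. x = sg_map q i x' \<and> y = sg_map q i y' \<and> adj q m x' y'"
  then obtain i x' y' w where *: "i < 3" "x = sg_map q i x'" "y = sg_map q i y'" "x' \<noteq> y'"
      "length w = m" "set w \<subseteq> {..<3}" "x' \<in> word_map q w ` V q 0" "y' \<in> word_map q w ` V q 0"
    unfolding adj_def by blast
  then show "adj q (Suc m) x y"
    unfolding adj_def
    by (intro conjI exI[of _ "i # w"]) (auto simp: sg_map_inj simp del: V.simps)
qed

text \<open>Edges are sorted by the first letter of their word. No edge is counted twice, because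
  two cells share at most one point and an edge has two.\<close>

lemma level_energy_Suc:
  "level_energy q (Suc m) u = 5/3 * (\<Sum>i<3. level_energy q m (u \<circ> sg_map q i))"
proof -
  let ?D = "\<lambda>m. {(x, y). adj q m x y}"
  let ?F = "\<lambda>i. map_prod (sg_map q i) (sg_map q i)"
  have D: "?D (Suc m) = (\<Union>i<3. ?F i ` ?D m)"
    by (force simp: adj_Suc)
  have inj: "inj_on (?F i) (?D m)" for i
    by (auto simp: inj_on_def sg_map_inj)
  have disj: "?F i ` ?D m \<inter> ?F j ` ?D m = {}" if "i < 3" "j < 3" "i \<noteq> j" for i j
  proof (rule ccontr)
    assume "?F i ` ?D m \<inter> ?F j ` ?D m \<noteq> {}"
    then obtain a b c d where *: "adj q m a b" "adj q m c d"
        "sg_map q i a = sg_map q j c" "sg_map q i b = sg_map q j d" by auto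
    then have "a \<in> SG q" "b \<in> SG q" "c \<in> SG q" "d \<in> SG q"
      using adj_imp_V V_subset_SG by blast+
    then have "a = q j" "b = q j" using cells_meet(1)[OF that] * by blast+
    with *(1) show False by (simp add: adj_def)
  qed
  have "(\<Sum>(x,y)\<in>?D (Suc m). (u x - u y)^2) = (\<Sum>i<3. \<Sum>(x,y)\<in>?F i ` ?D m. (u x - u y)^2)"
    unfolding D by (rule sum.UNION_disjoint) (use disj finite_adj in auto)
  also have "\<dots> = (\<Sum>i<3. \<Sum>(x,y)\<in>?D m. ((u \<circ> sg_map q i) x - (u \<circ> sg_map q i) y)^2)"
    by (rule sum.cong[OF refl], subst sum.reindex[OF inj]) (simp add: comp_def case_prod_unfold)
  finally show ?thesis
    unfolding level_energy_def by (simp add: sum_distrib_left sum_divide_distrib mult_ac)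
qed

lemma level_energy_0:
  "level_energy q 0 u = (u (q 0) - u (q 1))^2 + (u (q 1) - u (q 2))^2 + (u (q 2) - u (q 0))^2"
proof -
  have "{(x, y). adj q 0 x y}
    = {(q 0, q 1), (q 1, q 0), (q 1, q 2), (q 2, q 1), (q 2, q 0), (q 0, q 2)}"
    using vertex_eq_iff[of 0 1] vertex_eq_iff[of 1 2] vertex_eq_iff[of 2 0]
    by (auto simp: adj_def less_3)
  then show ?thesis
    using vertex_eq_iff[of 0 1] vertex_eq_iff[of 1 2] vertex_eq_iff[of 2 0]
      vertex_eq_iff[of 1 0] vertex_eq_iff[of 2 1] vertex_eq_iff[of 0 2]
    by (simp add: level_energy_def power2_commute)
qed

lemma sum_3: "(\<Sum>i<3. f i) = f 0 + f 1 + (f 2 :: real)" for f :: "nat \<Rightarrow> real"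
  by (simp add: eval_nat_numeral)

lemma level_energy_step: "level_energy q m u \<le> level_energy q (Suc m) u"
proof (induction m arbitrary: u)
  case 0
  have sos: "(a - b)^2 + (b - c)^2 + (c - a)^2 \<le>
    5/3 * (((a - x)^2 + (x - y)^2 + (y - a)^2) + ((x - b)^2 + (b - z)^2 + (z - x)^2)
       + ((y - z)^2 + (z - c)^2 + (c - y)^2))" for a b c x y z :: real
  proof -
    \<comment> \<open>\<open>e\<close>, \<open>f\<close>, \<open>g\<close> are the deviations of the
      midpoint values from the harmonic extension of \<open>a\<close>, \<open>b\<close>,
      \<open>c\<close>; in them the excess energy becomes a sum of squares.\<close>
    define e where "e = x - (2*a + 2*b + c) / 5"
    define f where "f = y - (2*a + b + 2*c) / 5"
    define g where "g = z - (a + 2*b + 2*c) / 5"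
    have "5/3 * (((a - x)^2 + (x - y)^2 + (y - a)^2) + ((x - b)^2 + (b - z)^2 + (z - x)^2)
       + ((y - z)^2 + (z - c)^2 + (c - y)^2)) - ((a - b)^2 + (b - c)^2 + (c - a)^2)
      = 5/3 * ((e - f)^2 + (f - g)^2 + (g - e)^2 + 2 * (e^2 + f^2 + g^2))"
      unfolding e_def f_def g_def by (simp add: power2_eq_square field_simps)
    also have "\<dots> \<ge> 0" by simp
    finally show ?thesis by linarith
  qed
  show ?case
    using sos[of "u (q 0)" "u (q 1)" "u (q 2)" "u (sg_map q 0 (q 1))"
        "u (sg_map q 0 (q 2))" "u (sg_map q 1 (q 2))"]
    unfolding level_energy_Suc sum_3 level_energy_0 comp_def sg_map_vertex
      sg_map_commute[of q 1 0] sg_map_commute[of q 2 0] sg_map_commute[of q 2 1] .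
next
  case (Suc m)
  then show ?case
    unfolding level_energy_Suc[of "Suc m"] level_energy_Suc[of m u]
    by (intro mult_left_mono sum_mono) auto
qed

lemma level_energy_mono: "m \<le> n \<Longrightarrow> level_energy q m u \<le> level_energy q n u"
  by (rule lift_Suc_mono_le[of "\<lambda>m. level_energy q m u"]) (rule level_energy_step)

text \<open>The level energies increase, so in \<open>ereal\<close> their limit exists and is the
  supremum, even for functions of infinite energy.\<close>

lemma energy_ge: "ereal (level_energy q m u) \<le> energy q u"
proof -
  have "incseq (\<lambda>m. ereal (level_energy q m u))"
    by (auto intro!: incseq_SucI level_energy_step)
  then show ?thesis
    unfolding energy_def by (subst limI[OF LIMSEQ_SUP]) (auto intro: SUP_upper)
qed

lemma energy_eventually_const:
  assumes "\<And>m. n \<le> m \<Longrightarrow> level_energy q m u = e"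
  shows "energy q u = ereal e"
  unfolding energy_def
  by (intro limI tendsto_eventually) (use assms in \<open>auto simp: eventually_sequentially\<close>)

section \<open>Gluing\<close>

text \<open>\<open>2 *\<^sub>R x - q i\<close> inverts \<open>sg_map q i\<close>. A junction point
  lies in two cells, and \<open>LEAST\<close> settles which piece is used.\<close>

definition glue :: "(nat \<Rightarrow> real^2 \<Rightarrow> real) \<Rightarrow> real^2 \<Rightarrow> real" where
  "glue w x = (let i = (LEAST i. i < 3 \<and> x \<in> sg_map q i ` SG q) in w i (2 *\<^sub>R x - q i))"

text \<open>Cells \<open>i\<close> and \<open>j\<close> meet in
  \<open>sg_map q i (q j) = sg_map q j (q i)\<close>; the two sides are the values which the pieces
  assign to this point.\<close>

definition compatible :: "(nat \<Rightarrow> real^2 \<Rightarrow> real) \<Rightarrow> bool" where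
  "compatible w \<longleftrightarrow> (\<forall>i<3. \<forall>j<3. w i (q j) = w j (q i))"

lemma glue_sg_map:
  assumes "compatible w" "i < 3" "x \<in> SG q"
  shows "glue w (sg_map q i x) = w i x"
proof -
  define P where "P j \<longleftrightarrow> j < 3 \<and> sg_map q i x \<in> sg_map q j ` SG q" for j
  define j where "j = Least P"
  have "P i" using assms by (auto simp: P_def)
  then have "P j" unfolding j_def by (rule LeastI)
  then obtain y where y: "j < 3" "y \<in> SG q" "sg_map q i x = sg_map q j y"
    unfolding P_def by auto
  have "glue w (sg_map q i x) = w j (2 *\<^sub>R sg_map q i x - q j)"
    by (simp add: glue_def Let_def j_def P_def[abs_def])
  also have "2 *\<^sub>R sg_map q i x - q j = y" unfolding y(3) by (simp add: sg_map_def)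
  also have "w j y = w i x"
  proof (cases "i = j")
    case True
    then show ?thesis using y(3) by (simp add: sg_map_inj)
  next
    case False
    then show ?thesis
      using cells_meet[OF assms(2) y(1) False assms(3) y(2,3)] assms y(1)
      by (simp add: compatible_def)
  qed
  finally show ?thesis .
qed

lemma continuous_glue:
  assumes "compatible w" "\<And>i. i < 3 \<Longrightarrow> continuous_on (SG q) (w i)"
  shows "continuous_on (SG q) (glue w)"
proof -
  have "continuous_on (sg_map q i ` SG q) (glue w)" if i: "i < 3" for i
  proof -
    have "continuous_on (sg_map q i ` SG q) (\<lambda>x. w i (2 *\<^sub>R x - q i))"
      by (rule continuous_on_compose2[OF assms(2)[OF i]])
        (auto intro!: continuous_intros simp: sg_map_def)
    then show ?thesis
      by (rule continuous_on_eq) (use glue_sg_map[OF assms(1) i] in \<open>auto simp: sg_map_def\<close>)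
  qed
  moreover have "closed (sg_map q i ` SG q)" for i
    by (intro compact_imp_closed compact_continuous_image continuous_sg_map compact_SG)
  ultimately have "continuous_on (\<Union>i\<in>{..<3}. sg_map q i ` SG q) (glue w)"
    by (intro continuous_on_closed_Union) auto
  then show ?thesis using SG_eq[of q] by simp
qed

lemma level_energy_cong: "(\<And>x. x \<in> SG q \<Longrightarrow> u x = v x) \<Longrightarrow> level_energy q m u = level_energy q m v"
  unfolding level_energy_def
  by (intro arg_cong2[where f="(*)"] arg_cong2[where f="(/)"] sum.cong refl)
    (auto dest!: adj_imp_V simp: subsetD[OF V_subset_SG])

lemma level_energy_glue:
  assumes "compatible w"
  shows "level_energy q (Suc m) (glue w) = 5/3 * (\<Sum>i<3. level_energy q m (w i))"
proof -
  have "level_energy q m (glue w \<circ> sg_map q i) = level_energy q m (w i)" if "i < 3" for i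
    by (rule level_energy_cong) (simp add: glue_sg_map[OF assms that])
  then show ?thesis unfolding level_energy_Suc by simp
qed

section \<open>Harmonic functions\<close>

text \<open>The values on \<open>V\<^sub>0\<close> of the restriction to the cell \<open>i\<close> of the harmonic function with
  values \<open>a\<close> on \<open>V\<^sub>0\<close> (the \<open>1/5\<close>--\<open>2/5\<close> rule).\<close>

definition sub :: "(nat \<Rightarrow> real) \<Rightarrow> nat \<Rightarrow> nat \<Rightarrow> real" where
  "sub a i j = (if i = j then a i else (a 0 + a 1 + a 2 + a i + a j) / 5)"

text \<open>The start interpolates the vertex values by hat functions of radius \<open>s\<close>,
  the side length, so that each hat vanishes at the other two vertices. Each further step imposes
  the harmonic rule on one more level.\<close>

primrec approx :: "nat \<Rightarrow> (nat \<Rightarrow> real) \<Rightarrow> real^2 \<Rightarrow> real" where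
  "approx 0 a = (\<lambda>x. a 0 + (a 1 - a 0) * max 0 (1 - dist x (q 1) / s)
      + (a 2 - a 0) * max 0 (1 - dist x (q 2) / s))"
| "approx (Suc m) a = glue (\<lambda>i. approx m (sub a i))"

lemma sub_commute: "sub a i j = sub a j i"
  by (simp add: sub_def)

lemma approx_vertex: "j < 3 \<Longrightarrow> approx m a (q j) = a j"
proof (induction m arbitrary: a j)
  case 0
  then show ?case
    using dist_vertices[of 0 1] dist_vertices[of 0 2] dist_vertices[of 1 2]
      dist_vertices[of 2 1] s_pos
    unfolding less_3 by auto
next
  case (Suc m)
  have "compatible (\<lambda>i. approx m (sub a i))"
    by (auto simp: compatible_def Suc.IH sub_commute)
  from glue_sg_map[OF this Suc.prems vertex_in_SG[OF Suc.prems]] show ?case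
    by (simp add: sg_map_vertex Suc.IH[OF Suc.prems] sub_def)
qed

lemma approx_compatible: "compatible (\<lambda>i. approx m (sub a i))"
  by (auto simp: compatible_def approx_vertex sub_commute)

lemma approx_sg_map:
  "i < 3 \<Longrightarrow> x \<in> SG q \<Longrightarrow> approx (Suc m) a (sg_map q i x) = approx m (sub a i) x"
  using glue_sg_map[OF approx_compatible] by simp

lemma continuous_approx: "continuous_on (SG q) (approx m a)"
proof (induction m arbitrary: a)
  case 0
  show ?case unfolding approx.simps using s_pos by (intro continuous_intros) auto
next
  case (Suc m)
  then show ?case using continuous_glue[OF approx_compatible] by simp
qed

definition osc_le :: "(nat \<Rightarrow> real) \<Rightarrow> real \<Rightarrow> bool" where
  "osc_le a r \<longleftrightarrow> \<bar>a 0 - a 1\<bar> \<le> r \<and> \<bar>a 1 - a 2\<bar> \<le> r \<and> \<bar>a 2 - a 0\<bar> \<le> r"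

text \<open>Differences within a cell have the form
  \<open>(2 * (a 0 - a 1) + (a 0 - a 2)) / 5\<close> or \<open>(a 1 - a 2) / 5\<close> up to
  relabelling and sign.\<close>

lemma osc_le_sub:
  assumes "osc_le a r" "i < 3" shows "osc_le (sub a i) (3/5 * r)"
proof -
  have "i = 0 \<or> i = 1 \<or> i = 2" using assms(2) by (simp only: less_3)
  then show ?thesis
    using assms(1) unfolding osc_le_def abs_le_iff
    by (elim disjE) (simp_all add: sub_def field_simps)
qed

lemma approx_0_bound:
  assumes "osc_le a r" shows "\<bar>approx 0 a x - a 0\<bar> \<le> 2 * r"
proof -
  define f g where "f = max 0 (1 - dist x (q 1) / s)" and "g = max 0 (1 - dist x (q 2) / s)"
  have fg: "0 \<le> f" "f \<le> 1" "0 \<le> g" "g \<le> 1" using s_pos by (auto simp: f_def g_def)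
  have "\<bar>(a 1 - a 0) * f\<bar> \<le> r * 1" "\<bar>(a 2 - a 0) * g\<bar> \<le> r * 1"
    unfolding abs_mult using assms fg by (intro mult_mono; force simp: osc_le_def)+
  moreover have "approx 0 a x - a 0 = (a 1 - a 0) * f + (a 2 - a 0) * g"
    by (simp add: f_def g_def)
  ultimately show ?thesis by linarith
qed

text \<open>Passing to a cell lowers \<open>m\<close> by one and the oscillation by the factor 3/5.
  At \<open>m = 0\<close> the triangle inequality gives \<open>6/5 * r + r + 2 * r\<close>, which is
  below \<open>5 * r\<close>.\<close>

lemma approx_step_bound:
  assumes "osc_le a r" "x \<in> SG q"
  shows "\<bar>approx (Suc m) a x - approx m a x\<bar> \<le> 5 * r * (3/5)^m"
  using assms
proof (induction m arbitrary: a r x)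
  case 0
  obtain i y where y: "i < 3" "y \<in> SG q" "x = sg_map q i y"
    using SG_cases[OF 0(2)] .
  have "\<bar>approx 0 (sub a i) y - sub a i 0\<bar> \<le> 2 * (3/5 * r)"
    by (rule approx_0_bound[OF osc_le_sub[OF 0(1) y(1)]])
  moreover have "\<bar>sub a i 0 - a 0\<bar> \<le> r"
  proof -
    have "i = 0 \<or> i = 1 \<or> i = 2" using y(1) by (simp only: less_3)
    then show ?thesis
      using 0(1) unfolding osc_le_def abs_le_iff
      by (elim disjE) (simp_all add: sub_def field_simps)
  qed
  moreover have "\<bar>approx 0 a x - a 0\<bar> \<le> 2 * r" by (rule approx_0_bound[OF 0(1)])
  moreover have "approx (Suc 0) a x = approx 0 (sub a i) y"
    using approx_sg_map[OF y(1,2), of 0] y(3) by simp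
  moreover have "0 \<le> r" using 0(1) unfolding osc_le_def by linarith
  ultimately show ?case unfolding power_0 by linarith
next
  case (Suc m)
  obtain i y where y: "i < 3" "y \<in> SG q" "x = sg_map q i y"
    using SG_cases[OF Suc.prems(2)] .
  show ?case
    using Suc.IH[OF osc_le_sub[OF Suc.prems(1) y(1)] y(2)]
    unfolding y(3) approx_sg_map[OF y(1,2)] by (simp add: mult_ac)
qed

definition harm :: "(nat \<Rightarrow> real) \<Rightarrow> real^2 \<Rightarrow> real" where
  "harm a x = lim (\<lambda>m. approx m a x)"

lemma uniform_limit_approx: "uniform_limit (SG q) (\<lambda>m. approx m a) (harm a) sequentially"
proof -
  define r where "r = \<bar>a 0 - a 1\<bar> + \<bar>a 1 - a 2\<bar> + \<bar>a 2 - a 0\<bar>"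
  have r: "osc_le a r" by (auto simp: osc_le_def r_def)
  define f where "f m x = approx (Suc m) a x - approx m a x" for m x
  \<comment> \<open>The approximations are partial sums of a telescoping series with a geometric
    majorant.\<close>
  have "uniform_limit (SG q) (\<lambda>n x. \<Sum>m<n. f m x) (\<lambda>x. \<Sum>m. f m x) sequentially"
  proof (rule Weierstrass_m_test)
    show "norm (f n x) \<le> 5 * r * (3/5)^n" if "x \<in> SG q" for n x
      using approx_step_bound[OF r that] by (simp only: f_def real_norm_def)
    show "summable (\<lambda>n. 5 * r * (3/5)^n)"
      by (intro summable_mult summable_geometric) simp
  qed
  then have "uniform_limit (SG q) (\<lambda>n x. approx 0 a x + (\<Sum>m<n. f m x))
      (\<lambda>x. approx 0 a x + (\<Sum>m. f m x)) sequentially"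
    by (intro uniform_limit_add uniform_limit_const)
  moreover have "approx 0 a x + (\<Sum>m<n. f m x) = approx n a x" for n x
    by (induction n) (auto simp: f_def simp del: approx.simps)
  ultimately have *: "uniform_limit (SG q) (\<lambda>m. approx m a)
      (\<lambda>x. approx 0 a x + (\<Sum>m. f m x)) sequentially" by simp
  show ?thesis
    by (rule uniform_limit_cong'[THEN iffD1, OF _ _ *])
      (simp_all add: harm_def limI[OF tendsto_uniform_limitI[OF *]] del: approx.simps)
qed

lemma tendsto_harm: "x \<in> SG q \<Longrightarrow> (\<lambda>m. approx m a x) \<longlonglongrightarrow> harm a x"
  by (rule tendsto_uniform_limitI[OF uniform_limit_approx])

lemma continuous_harm: "continuous_on (SG q) (harm a)"
  by (rule uniform_limit_theorem[OF _ uniform_limit_approx])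
    (simp_all add: continuous_approx)

lemma harm_vertex: "j < 3 \<Longrightarrow> harm a (q j) = a j"
  by (simp add: harm_def approx_vertex)

lemma harm_sg_map:
  assumes "i < 3" "x \<in> SG q"
  shows "harm a (sg_map q i x) = harm (sub a i) x"
proof (rule LIMSEQ_unique)
  show "(\<lambda>m. approx m (sub a i) x) \<longlonglongrightarrow> harm (sub a i) x"
    by (rule tendsto_harm[OF assms(2)])
  show "(\<lambda>m. approx m (sub a i) x) \<longlonglongrightarrow> harm a (sg_map q i x)"
    using LIMSEQ_Suc[OF tendsto_harm[OF sg_map_in_SG[OF assms], of a]]
    by (simp only: approx_sg_map[OF assms])
qed

text \<open>By the harmonic rule the triangle energies of the three cells add up to 3/5 of that of
  the whole, which cancels the factor 5/3.\<close>

lemma level_energy_harm: "level_energy q m (harm a) = (a 0 - a 1)^2 + (a 1 - a 2)^2 + (a 2 - a 0)^2"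
proof (induction m arbitrary: a)
  case 0
  show ?case by (simp add: level_energy_0 harm_vertex)
next
  case (Suc m)
  have "level_energy q m (harm a \<circ> sg_map q i) = level_energy q m (harm (sub a i))" if "i < 3" for i
    by (rule level_energy_cong) (simp add: harm_sg_map[OF that])
  then have "level_energy q (Suc m) (harm a) = 5/3 * (\<Sum>i<3. level_energy q m (harm (sub a i)))"
    unfolding level_energy_Suc by simp
  also have "\<dots> = (a 0 - a 1)^2 + (a 1 - a 2)^2 + (a 2 - a 0)^2"
    unfolding Suc.IH sum_3 by (simp add: sub_def power2_eq_square field_simps)
  finally show ?case .
qed

end

section \<open>Trace on the bottom row and the top\<close>

text \<open>\<open>lo\<close> and \<open>hi\<close> extend a function on a row by zero to the next
  row, placed on its left or right half. Both halves contain the midpoint \<open>N\<close>, where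
  contributions add up.\<close>

definition lo :: "nat \<Rightarrow> (nat \<Rightarrow> real) \<Rightarrow> nat \<Rightarrow> real" where
  "lo N f k = (if k \<le> N then f k else 0)"

definition hi :: "nat \<Rightarrow> (nat \<Rightarrow> real) \<Rightarrow> nat \<Rightarrow> real" where
  "hi N f k = (if N \<le> k then f (k - N) else 0)"

lemma sum_lo: "(\<Sum>k\<le>2*N. lo N f k * g k) = (\<Sum>k\<le>N. f k * g k)"
proof -
  have "(\<Sum>k\<le>N. f k * g k) = (\<Sum>k\<le>N. lo N f k * g k)"
    by (rule sum.cong) (auto simp: lo_def)
  also have "\<dots> = (\<Sum>k\<le>2*N. lo N f k * g k)"
    by (rule sum.mono_neutral_left) (auto simp: lo_def)
  finally show ?thesis by simp
qed

lemma sum_hi: "(\<Sum>k\<le>2*N. hi N f k * g k) = (\<Sum>k\<le>N. f k * g (N + k))"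
proof -
  have "(\<Sum>k\<le>N. f k * g (N + k)) = (\<Sum>k\<in>{N..2*N}. hi N f k * g k)"
    by (rule sum.reindex_bij_witness[of _ "\<lambda>k. k - N" "\<lambda>k. N + k"]) (auto simp: hi_def)
  also have "\<dots> = (\<Sum>k\<le>2*N. hi N f k * g k)"
    by (rule sum.mono_neutral_left) (auto simp: hi_def)
  finally show ?thesis by simp
qed

text \<open>\<open>tau n i\<close> is the conductance between \<open>q\<^sub>0\<close> and \<open>x\<^sub>i\<close>, and \<open>tot n\<close> is the sum of these
  over the bottom row; \<open>1 / tot n\<close> obeys the affine recursion
  \<open>1 / tot (n + 1) = 3/10 * (1 + 1 / tot n)\<close>, whence the closed forms.\<close>

definition tot :: "nat \<Rightarrow> real" where
  "tot n = 14 * 10^n / (3^n + 6 * 10^n)"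

definition tau :: "nat \<Rightarrow> nat \<Rightarrow> real" where
  "tau n i = (if i = 0 \<or> i = 2^n then 1 else 2) * (tot n / (2 * 2^n))"

lemma tot_nonneg: "tot n \<ge> 0"
  by (simp add: tot_def add_nonneg_nonneg)

lemma tot_Suc: "tot (Suc n) = 10/3 * (tot n / (tot n + 1))"
proof -
  have "(0::real) < 3^n + 6 * 10^n" "(0::real) < 3^n + 20 * 10^n"
    by (simp_all add: add_pos_pos)
  moreover have "3 ^ Suc n + 6 * 10 ^ Suc n = 3 * (3^n + 20 * (10::real)^n)" by simp
  moreover have "tot n + 1 = (3^n + 20 * 10^n) / (3^n + 6 * 10^n)"
    using calculation(1) by (simp add: tot_def field_simps)
  ultimately show ?thesis unfolding tot_def[of "Suc n"] by (simp add: tot_def)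
qed

lemma tau_Suc:
  assumes "k \<le> 2 * 2^n"
  shows "tau (Suc n) k = 5/3 / (tot n + 1) * (lo (2^n) (tau n) k + hi (2^n) (tau n) k)"
proof -
  let ?w = "\<lambda>n k. if k = 0 \<or> k = 2^n then 1 else 2 :: real"
  \<comment> \<open>The weights 1, 2, ..., 2, 1 of the halves add up to those of the whole row; the
    midpoint receives 1 + 1.\<close>
  have w: "?w (Suc n) k = lo (2^n) (?w n) k + hi (2^n) (?w n) k"
    using assms by (auto simp: lo_def hi_def)
  have "lo (2^n) (tau n) k = lo (2^n) (?w n) k * (tot n / (2 * 2^n))"
    "hi (2^n) (tau n) k = hi (2^n) (?w n) k * (tot n / (2 * 2^n))"
    by (auto simp: lo_def hi_def tau_def)
  moreover have "tot (Suc n) / (2 * 2 ^ Suc n) = 5/3 / (tot n + 1) * (tot n / (2 * 2^n))"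
    by (simp add: tot_Suc divide_divide_eq_left times_divide_times_eq mult.left_commute)
  ultimately show ?thesis
    unfolding tau_def[of "Suc n"] w by (simp add: algebra_simps)
qed

lemma sum_tau: "(\<Sum>k\<le>2^n. tau n k) = tot n"
proof (induction n)
  case 0
  show ?case by (simp add: tau_def atMost_Suc)
next
  case (Suc n)
  have "(\<Sum>k\<le>2^Suc n. tau (Suc n) k)
    = 5/3 / (tot n + 1) * ((\<Sum>k\<le>2*2^n. lo (2^n) (tau n) k * 1) + (\<Sum>k\<le>2*2^n. hi (2^n) (tau n) k * 1))"
    unfolding sum.distrib[symmetric] sum_distrib_left
    by (intro sum.cong) (simp_all add: tau_Suc)
  then show ?case unfolding sum_lo sum_hi by (simp add: Suc tot_Suc)
qed

text \<open>The terms with \<open>tau\<close> come from eliminating the points \<open>F\<^sub>1 q\<^sub>0\<close> and \<open>F\<^sub>2 q\<^sub>0\<close> of the network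
  on level \<open>n + 1\<close>.\<close>

primrec cond :: "nat \<Rightarrow> nat \<Rightarrow> nat \<Rightarrow> real" where
  "cond 0 i j = (if i = j then 0 else 1)"
| "cond (Suc n) i j = 5/3 *
     (lo (2^n) (\<lambda>i. lo (2^n) (cond n i) j) i + hi (2^n) (\<lambda>i. hi (2^n) (cond n i) j) i
      + (tot n + 2) / ((tot n + 1) * (tot n + 3)) *
          (lo (2^n) (tau n) i * lo (2^n) (tau n) j + hi (2^n) (tau n) i * hi (2^n) (tau n) j)
      + 1 / ((tot n + 1) * (tot n + 3)) *
          (lo (2^n) (tau n) i * hi (2^n) (tau n) j + hi (2^n) (tau n) i * lo (2^n) (tau n) j))"

lemma cond_commute: "cond n i j = cond n j i"
  by (induction n arbitrary: i j) (auto simp: lo_def hi_def mult_ac)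

section \<open>The quadratic form of the trace and elimination of the junction points\<close>

definition form :: "nat \<Rightarrow> real \<Rightarrow> (nat \<Rightarrow> real) \<Rightarrow> real" where
  "form n t g = (\<Sum>i\<le>2^n. \<Sum>j\<le>2^n. cond n i j * (g i - g j)^2) / 2
     + (\<Sum>i\<le>2^n. tau n i * (t - g i)^2)"

text \<open>Product weights reduce the double sum to moments of order 0, 1 and 2, which turns the
  elimination into an identity between a few real numbers.\<close>

lemma sum_sum_sq_diff:
  fixes a b x y :: "nat \<Rightarrow> real"
  shows "(\<Sum>i\<in>I. \<Sum>j\<in>J. a i * b j * (x i - y j)^2)
    = sum b J * (\<Sum>i\<in>I. a i * (x i)^2) + sum a I * (\<Sum>j\<in>J. b j * (y j)^2)
      - 2 * (\<Sum>i\<in>I. a i * x i) * (\<Sum>j\<in>J. b j * y j)"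
proof -
  have "(\<Sum>i\<in>I. \<Sum>j\<in>J. a i * b j * (x i - y j)^2)
    = (\<Sum>i\<in>I. \<Sum>j\<in>J. (a i * (x i)^2) * b j + a i * (b j * (y j)^2) - 2 * ((a i * x i) * (b j * y j)))"
    by (intro sum.cong refl) (simp add: power2_eq_square algebra_simps)
  also have "\<dots> = (\<Sum>i\<in>I. a i * (x i)^2) * sum b J + sum a I * (\<Sum>j\<in>J. b j * (y j)^2)
      - 2 * ((\<Sum>i\<in>I. a i * x i) * (\<Sum>j\<in>J. b j * y j))"
    unfolding sum_subtractf sum.distrib sum_distrib_left[symmetric] sum_distrib_right[symmetric] ..
  finally show ?thesis by (simp add: mult_ac)
qed

lemma sum_sq_diff:
  fixes a x :: "nat \<Rightarrow> real"
  shows "(\<Sum>i\<in>I. a i * (t - x i)^2)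
    = sum a I * t^2 - 2 * t * (\<Sum>i\<in>I. a i * x i) + (\<Sum>i\<in>I. a i * (x i)^2)"
proof -
  have "(\<Sum>i\<in>I. a i * (t - x i)^2) = (\<Sum>i\<in>I. a i * t^2 - 2 * t * (a i * x i) + a i * (x i)^2)"
    by (intro sum.cong refl) (simp add: power2_eq_square algebra_simps)
  then show ?thesis by (simp add: sum.distrib sum_subtractf sum_distrib_left sum_distrib_right)
qed

text \<open>Completing the square in \<open>p1\<close> and \<open>p2\<close>. The quadratic part has
  diagonal \<open>T + 2\<close>, off-diagonal -1 and determinant \<open>(T + 1) * (T + 3)\<close>;
  the subtracted fractions are the critical point. \<open>M1\<close>, \<open>M2\<close> and
  \<open>N1\<close>, \<open>N2\<close> stand for first and second moments of the two halves.\<close>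

lemma eliminate_two:
  fixes T t p1 p2 M1 M2 N1 N2 :: real
  assumes "T \<ge> 0"
  shows "(t - p1)^2 + (t - p2)^2 + (p1 - p2)^2
      + (T * p1^2 - 2 * p1 * M1 + N1) + (T * p2^2 - 2 * p2 * M2 + N2)
    = (T + 2) / ((T + 1) * (T + 3)) * ((T * N1 - M1^2) + (T * N2 - M2^2))
      + 1 / ((T + 1) * (T + 3)) * (T * N1 + T * N2 - 2 * M1 * M2)
      + 1 / (T + 1) * ((T * t^2 - 2 * t * M1 + N1) + (T * t^2 - 2 * t * M2 + N2))
      + ((p1 - ((T + 2) * (t + M1) + (t + M2)) / ((T + 1) * (T + 3)))^2
        + (p2 - ((T + 2) * (t + M2) + (t + M1)) / ((T + 1) * (T + 3)))^2) * (T + 1)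
      + ((p1 - ((T + 2) * (t + M1) + (t + M2)) / ((T + 1) * (T + 3)))
        - (p2 - ((T + 2) * (t + M2) + (t + M1)) / ((T + 1) * (T + 3))))^2"
proof -
  have nz: "T + 1 \<noteq> 0" "T + 3 \<noteq> 0" using assms by auto
  \<comment> \<open>Reciprocals become variables with polynomial relations, so that the claim is an
    ideal membership.\<close>
  define A B where "A = 1 / (T + 1)" and "B = 1 / (T + 3)"
  have AB: "A * (T + 1) = 1" "B * (T + 3) = 1" using nz by (simp_all add: A_def B_def)
  have *: "1 / (T + 1) = A" "1 / ((T + 1) * (T + 3)) = A * B" "\<And>x. x / ((T + 1) * (T + 3)) = x * (A * B)"
    by (simp_all add: A_def B_def)
  show ?thesis unfolding * using AB by algebra
qed

text \<open>The energy-minimising values at \<open>F\<^sub>1 q\<^sub>0\<close> and \<open>F\<^sub>2 q\<^sub>0\<close> are \<open>opt n t M1 M2\<close> and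
  \<open>opt n t M2 M1\<close>, where \<open>M1\<close>, \<open>M2\<close> are the \<open>tau\<close>-weighted sums of the prescribed values
  over the left and the right half of the bottom row.\<close>

definition opt :: "nat \<Rightarrow> real \<Rightarrow> real \<Rightarrow> real \<Rightarrow> real" where
  "opt n t M1 M2 = ((tot n + 2) * (t + M1) + (t + M2)) / ((tot n + 1) * (tot n + 3))"

text \<open>The left side is the energy of three cells with values \<open>p1\<close> and
  \<open>p2\<close> at the junctions below the top. The excess on the right is nonnegative and
  vanishes at the \<open>opt\<close> values, so \<open>form (Suc n) t g\<close> is the minimum over
  \<open>p1\<close> and \<open>p2\<close>.\<close>

lemma form_Suc:
  fixes g :: "nat \<Rightarrow> real"
  defines "M1 n \<equiv> \<Sum>k\<le>2^n. tau n k * g k" and "M2 n \<equiv> \<Sum>k\<le>2^n. tau n k * g (2^n + k)"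
  shows "5/3 * ((t - p1)^2 + (p1 - p2)^2 + (p2 - t)^2 + form n p1 g + form n p2 (\<lambda>k. g (2^n + k)))
    = form (Suc n) t g
      + 5/3 * (((p1 - opt n t (M1 n) (M2 n))^2 + (p2 - opt n t (M2 n) (M1 n))^2) * (tot n + 1)
        + ((p1 - opt n t (M1 n) (M2 n)) - (p2 - opt n t (M2 n) (M1 n)))^2)"
proof -
  let ?N = "2^n :: nat" and ?T = "tot n" and ?L = "lo (2^n) (tau n)" and ?H = "hi (2^n) (tau n)"
  let ?I = "{..2 * ?N}"
  define N1 N2 where "N1 = (\<Sum>k\<le>2^n. tau n k * (g k)^2)"
    and "N2 = (\<Sum>k\<le>2^n. tau n k * (g (2^n + k))^2)"
  define S1 S2 where "S1 = (\<Sum>i\<le>2^n. \<Sum>j\<le>2^n. cond n i j * (g i - g j)^2)"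
    and "S2 = (\<Sum>i\<le>2^n. \<Sum>j\<le>2^n. cond n i j * (g (2^n + i) - g (2^n + j))^2)"
  note M = M1_def M2_def N1_def N2_def
  have LH: "sum ?L ?I = ?T" "sum ?H ?I = ?T"
    using sum_lo[of ?N "tau n" "\<lambda>_. 1"] sum_hi[of ?N "tau n" "\<lambda>_. 1"] by (simp_all add: sum_tau)
  have LL: "(\<Sum>i\<in>?I. \<Sum>j\<in>?I. ?L i * ?L j * (g i - g j)^2) = 2 * (?T * N1 - (M1 n)^2)"
    unfolding sum_sum_sq_diff sum_lo LH M by (simp add: power2_eq_square)
  have HH: "(\<Sum>i\<in>?I. \<Sum>j\<in>?I. ?H i * ?H j * (g i - g j)^2) = 2 * (?T * N2 - (M2 n)^2)"
    unfolding sum_sum_sq_diff sum_hi LH M by (simp add: power2_eq_square)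
  have LHc: "(\<Sum>i\<in>?I. \<Sum>j\<in>?I. ?L i * ?H j * (g i - g j)^2) = ?T * N1 + ?T * N2 - 2 * M1 n * M2 n"
    "(\<Sum>i\<in>?I. \<Sum>j\<in>?I. ?H i * ?L j * (g i - g j)^2) = ?T * N1 + ?T * N2 - 2 * M1 n * M2 n"
    unfolding sum_sum_sq_diff sum_hi sum_lo LH M by simp_all
  \<comment> \<open>The outer cutoff acts on \<open>i\<close>, so \<open>i\<close> must first become
    the inner summation variable; swapping back then exposes the cutoff in \<open>j\<close>.\<close>
  have S: "(\<Sum>i\<in>?I. \<Sum>j\<in>?I. lo ?N (\<lambda>i. lo ?N (cond n i) j) i * (g i - g j)^2) = S1"
    "(\<Sum>i\<in>?I. \<Sum>j\<in>?I. hi ?N (\<lambda>i. hi ?N (cond n i) j) i * (g i - g j)^2) = S2"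
    unfolding S1_def S2_def
    by (subst sum.swap, simp only: sum_lo sum_hi, subst sum.swap, simp only: sum_lo sum_hi)+
  have "(\<Sum>i\<le>2^Suc n. \<Sum>j\<le>2^Suc n. cond (Suc n) i j * (g i - g j)^2)
    = (\<Sum>i\<in>?I. \<Sum>j\<in>?I. 5/3 * (lo ?N (\<lambda>i. lo ?N (cond n i) j) i * (g i - g j)^2)
       + 5/3 * (hi ?N (\<lambda>i. hi ?N (cond n i) j) i * (g i - g j)^2)
       + 5/3 * ((?T + 2) / ((?T + 1) * (?T + 3))) * (?L i * ?L j * (g i - g j)^2)
       + 5/3 * ((?T + 2) / ((?T + 1) * (?T + 3))) * (?H i * ?H j * (g i - g j)^2)
       + 5/3 * (1 / ((?T + 1) * (?T + 3))) * (?L i * ?H j * (g i - g j)^2)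
       + 5/3 * (1 / ((?T + 1) * (?T + 3))) * (?H i * ?L j * (g i - g j)^2))"
    unfolding cond.simps power_Suc[of 2 n] by (intro sum.cong refl) (simp only: algebra_simps)
  also have "\<dots> = 5/3 * S1 + 5/3 * S2
       + 5/3 * ((?T + 2) / ((?T + 1) * (?T + 3))) * (2 * (?T * N1 - (M1 n)^2))
       + 5/3 * ((?T + 2) / ((?T + 1) * (?T + 3))) * (2 * (?T * N2 - (M2 n)^2))
       + 5/3 * (1 / ((?T + 1) * (?T + 3))) * (?T * N1 + ?T * N2 - 2 * M1 n * M2 n)
       + 5/3 * (1 / ((?T + 1) * (?T + 3))) * (?T * N1 + ?T * N2 - 2 * M1 n * M2 n)"
    unfolding sum.distrib sum_distrib_left[symmetric] LL HH LHc S ..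
  finally have C: "(\<Sum>i\<le>2^Suc n. \<Sum>j\<le>2^Suc n. cond (Suc n) i j * (g i - g j)^2) = \<dots>" .
  have "(\<Sum>i\<le>2^Suc n. tau (Suc n) i * (t - g i)^2)
    = (\<Sum>i\<in>?I. 5/3 * (1 / (?T + 1)) * (?L i * (t - g i)^2) + 5/3 * (1 / (?T + 1)) * (?H i * (t - g i)^2))"
    by (intro sum.cong) (simp_all add: tau_Suc algebra_simps)
  also have "\<dots> = 5/3 * (1 / (?T + 1)) * (?T * t^2 - 2 * t * M1 n + N1)
     + 5/3 * (1 / (?T + 1)) * (?T * t^2 - 2 * t * M2 n + N2)"
    unfolding sum.distrib sum_distrib_left[symmetric] sum_sq_diff LH sum_lo sum_hi M ..
  finally have D: "(\<Sum>i\<le>2^Suc n. tau (Suc n) i * (t - g i)^2) = \<dots>" .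
  have F: "form n p1 g = S1 / 2 + (?T * p1^2 - 2 * p1 * M1 n + N1)"
    "form n p2 (\<lambda>k. g (2^n + k)) = S2 / 2 + (?T * p2^2 - 2 * p2 * M2 n + N2)"
    unfolding form_def sum_sq_diff sum_tau S1_def S2_def M by simp_all
  have F': "form (Suc n) t g = 5/3 * (S1 / 2 + S2 / 2
     + (?T + 2) / ((?T + 1) * (?T + 3)) * ((?T * N1 - (M1 n)^2) + (?T * N2 - (M2 n)^2))
     + 1 / ((?T + 1) * (?T + 3)) * (?T * N1 + ?T * N2 - 2 * M1 n * M2 n)
     + 1 / (?T + 1) * ((?T * t^2 - 2 * t * M1 n + N1) + (?T * t^2 - 2 * t * M2 n + N2)))"
  proof -
    \<comment> \<open>Naming the coefficients keeps \<open>field_simps\<close> from clearing their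
      denominators.\<close>
    define \<alpha> \<beta> \<gamma> where "\<alpha> = (?T + 2) / ((?T + 1) * (?T + 3))"
      and "\<beta> = 1 / ((?T + 1) * (?T + 3))" and "\<gamma> = 1 / (?T + 1)"
    show ?thesis
      unfolding form_def C D \<alpha>_def[symmetric] \<beta>_def[symmetric] \<gamma>_def[symmetric]
      by (simp add: field_simps)
  qed
  have "(t - p1)^2 + (p1 - p2)^2 + (p2 - t)^2 + form n p1 g + form n p2 (\<lambda>k. g (2^n + k))
    = S1 / 2 + S2 / 2 + ((t - p1)^2 + (t - p2)^2 + (p1 - p2)^2
      + (?T * p1^2 - 2 * p1 * M1 n + N1) + (?T * p2^2 - 2 * p2 * M2 n + N2))"
    unfolding F power2_commute[of p2 t] by simp
  then show ?thesis
    unfolding F' eliminate_two[OF tot_nonneg] opt_def distrib_left[symmetric]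
    by (simp only: add.assoc)
qed

section \<open>The trace form as the least energy\<close>

context equilateral_triangle
begin

text \<open>By induction on the two lower cells; the top cell is bounded below by its triangle
  energy. Whatever values \<open>u\<close> has at the junctions, the excess in
  \<open>form_Suc\<close> is nonnegative.\<close>

lemma form_le_level_energy:
  "form n (u (q 0)) (\<lambda>i. u (bottom_pt q n i)) \<le> level_energy q n u"
proof (induction n arbitrary: u)
  case 0
  have "tau 0 k = 1" if "k \<le> 1" for k using that by (auto simp: tau_def tot_def le_Suc_eq)
  then show ?case
    using bottom_pt_ends[of 0]
    by (simp add: form_def level_energy_0 atMost_Suc power2_commute)
next
  case (Suc n)
  let ?p = "u (sg_map q 1 (q 0))" and ?r = "u (sg_map q 2 (q 0))" and ?t = "u (q 0)"
  let ?g = "\<lambda>i. u (bottom_pt q (Suc n) i)"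
  have "form n ?p ?g \<le> level_energy q n (u \<circ> sg_map q 1)"
    using Suc.IH[of "u \<circ> sg_map q 1"] by (simp only: comp_def sg_map_bottom_pt)
  moreover have "form n ?r (\<lambda>k. ?g (2^n + k)) \<le> level_energy q n (u \<circ> sg_map q 2)"
    using Suc.IH[of "u \<circ> sg_map q 2"] by (simp only: comp_def sg_map_bottom_pt)
  moreover have "(?t - ?p)^2 + (?p - ?r)^2 + (?r - ?t)^2 \<le> level_energy q n (u \<circ> sg_map q 0)"
    using level_energy_mono[of 0 n "u \<circ> sg_map q 0"]
    unfolding level_energy_0 comp_def sg_map_vertex
      sg_map_commute[of q 0 1] sg_map_commute[of q 0 2] by simp
  ultimately have "5/3 * ((?t - ?p)^2 + (?p - ?r)^2 + (?r - ?t)^2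
      + form n ?p ?g + form n ?r (\<lambda>k. ?g (2^n + k))) \<le> level_energy q (Suc n) u"
    unfolding level_energy_Suc sum_3 by (intro mult_left_mono) simp_all
  moreover have "form (Suc n) ?t ?g \<le> 5/3 * ((?t - ?p)^2 + (?p - ?r)^2 + (?r - ?t)^2
      + form n ?p ?g + form n ?r (\<lambda>k. ?g (2^n + k)))"
    unfolding form_Suc[where g = ?g] using tot_nonneg[of n] by simp
  ultimately show ?case by linarith
qed

text \<open>A harmonic function on the top cell is glued to extremal functions on the lower cells,
  with the \<open>opt\<close> values at the junctions, so that the excess in \<open>form_Suc\<close>
  is zero.\<close>

lemma form_attained:
  "\<exists>u. continuous_on (SG q) u \<and> u (q 0) = t \<and> (\<forall>i\<le>2^n. u (bottom_pt q n i) = g i)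
     \<and> (\<forall>m\<ge>n. level_energy q m u = form n t g)"
proof (induction n arbitrary: t g)
  case 0
  \<comment> \<open>Index shift: \<open>bottom_pt q 0 i\<close> is the vertex with index
    \<open>i + 1\<close>.\<close>
  let ?u = "harm (\<lambda>k. if k = 0 then t else g (k - 1))"
  have "tau 0 k = 1" if "k \<le> 1" for k using that by (auto simp: tau_def tot_def le_Suc_eq)
  then have "form 0 t g = (t - g 0)^2 + (g 0 - g 1)^2 + (g 1 - t)^2"
    by (simp add: form_def atMost_Suc power2_commute)
  moreover have "\<forall>i\<le>2^0. ?u (bottom_pt q 0 i) = g i"
    using bottom_pt_ends[of 0] by (auto simp: harm_vertex le_Suc_eq)
  ultimately show ?case
    by (intro exI[of _ ?u]) (simp add: continuous_harm harm_vertex level_energy_harm)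
next
  case (Suc n)
  define M1 M2 where "M1 = (\<Sum>k\<le>2^n. tau n k * g k)"
    and "M2 = (\<Sum>k\<le>2^n. tau n k * g (2^n + k))"
  define p1 p2 where "p1 = opt n t M1 M2" and "p2 = opt n t M2 M1"
  obtain u1 where u1: "continuous_on (SG q) u1" "u1 (q 0) = p1"
      "\<And>i. i \<le> 2^n \<Longrightarrow> u1 (bottom_pt q n i) = g i"
      "\<And>m. n \<le> m \<Longrightarrow> level_energy q m u1 = form n p1 g"
    using Suc.IH[of p1 g] by blast
  obtain u2 where u2: "continuous_on (SG q) u2" "u2 (q 0) = p2"
      "\<And>i. i \<le> 2^n \<Longrightarrow> u2 (bottom_pt q n i) = g (2^n + i)"
      "\<And>m. n \<le> m \<Longrightarrow> level_energy q m u2 = form n p2 (\<lambda>k. g (2^n + k))"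
    using Suc.IH[of p2 "\<lambda>k. g (2^n + k)"] by blast
  define u0 where "u0 = harm (\<lambda>k. if k = 0 then t else if k = 1 then p1 else p2)"
  have u0: "continuous_on (SG q) u0" "u0 (q 0) = t" "u0 (q 1) = p1" "u0 (q 2) = p2"
      "\<And>m. level_energy q m u0 = (t - p1)^2 + (p1 - p2)^2 + (p2 - t)^2"
    by (simp_all add: u0_def continuous_harm harm_vertex level_energy_harm)
  define w where "w i = (if i = 0 then u0 else if i = 1 then u1 else u2)" for i :: nat
  \<comment> \<open>The lower cells meet at the midpoint of the new row, the last point of the left
    half and the first of the right half.\<close>
  have "u1 (q 2) = g (2^n)" "u2 (q 1) = g (2^n)"
    using u1(3)[of "2^n"] u2(3)[of 0] by (simp_all add: bottom_pt_ends)
  then have comp: "compatible w"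
    using u0 u1(2) u2(2) unfolding compatible_def less_3 w_def by auto
  have "continuous_on (SG q) (glue w)"
    by (rule continuous_glue[OF comp]) (simp add: w_def u0(1) u1(1) u2(1))
  moreover have "glue w (q 0) = t"
    using glue_sg_map[OF comp, of 0 "q 0"] u0(2) by (simp add: sg_map_vertex vertex_in_SG w_def)
  moreover have "glue w (bottom_pt q (Suc n) i) = g i" if i: "i \<le> 2^Suc n" for i
  proof (cases "i \<le> 2^n")
    case True
    then show ?thesis
      using glue_sg_map[OF comp, of 1 "bottom_pt q n i"] u1(3)[of i] bottom_pt_in_SG[of i n]
      by (simp add: sg_map_bottom_pt w_def flip: One_nat_def)
  next
    case False
    then obtain k where k: "i = 2^n + k" "k \<le> 2^n" using i by (auto simp: dest: less_imp_add_positive intro!: that[of "i - 2^n"])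
    then show ?thesis
      using glue_sg_map[OF comp, of 2 "bottom_pt q n k"] u2(3)[of k] bottom_pt_in_SG[of k n]
      by (simp add: sg_map_bottom_pt w_def)
  qed
  moreover have "level_energy q m (glue w) = form (Suc n) t g" if m: "Suc n \<le> m" for m
  proof -
    obtain l where l: "m = Suc l" "n \<le> l" using m by (cases m) auto
    have "level_energy q m (glue w) = 5/3 * ((t - p1)^2 + (p1 - p2)^2 + (p2 - t)^2
       + form n p1 g + form n p2 (\<lambda>k. g (2^n + k)))"
      unfolding l level_energy_glue[OF comp] sum_3
      by (simp add: w_def u0(5) u1(4)[OF l(2)] u2(4)[OF l(2)])
    then show ?thesis
      unfolding form_Suc by (simp add: p1_def p2_def M1_def M2_def)
  qed
  ultimately show ?case by blast
qed

section \<open>Conductances\<close>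

text \<open>The function from \<open>form_attained\<close> has constant level energy from
  \<open>n\<close> on, and every competitor already has at least this energy at level
  \<open>n\<close>.\<close>

lemma least_energy_ext_exists:
  "\<exists>u. least_energy_ext q (bottom_row_with_top q n) f u
     \<and> energy q u = ereal (form n (f (q 0)) (\<lambda>i. f (bottom_pt q n i)))"
proof -
  obtain u where u: "continuous_on (SG q) u" "u (q 0) = f (q 0)"
      "\<And>i. i \<le> 2^n \<Longrightarrow> u (bottom_pt q n i) = f (bottom_pt q n i)"
      "\<And>m. n \<le> m \<Longrightarrow> level_energy q m u = form n (f (q 0)) (\<lambda>i. f (bottom_pt q n i))"
    using form_attained[of "f (q 0)" n "\<lambda>i. f (bottom_pt q n i)"] by blast
  have e: "energy q u = ereal (form n (f (q 0)) (\<lambda>i. f (bottom_pt q n i)))"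
    by (rule energy_eventually_const[OF u(4)])
  have "energy q u \<le> energy q v" if "\<forall>x\<in>bottom_row_with_top q n. v x = f x" for v
  proof -
    have "form n (f (q 0)) (\<lambda>i. f (bottom_pt q n i)) = form n (v (q 0)) (\<lambda>i. v (bottom_pt q n i))"
      using that by (simp add: form_def bottom_row_with_top_def)
    also have "ereal \<dots> \<le> ereal (level_energy q n v)" using form_le_level_energy by simp
    also have "\<dots> \<le> energy q v" by (rule energy_ge)
    finally show ?thesis unfolding e .
  qed
  then have "least_energy_ext q (bottom_row_with_top q n) f u"
    unfolding least_energy_ext_def dom_energy_def using u e by (auto simp: bottom_row_with_top_def)
  with e show ?thesis by blast
qed

text \<open>Two minimisers for the same data have equal energy, so the formula passes from the
  constructed one to every other.\<close>

lemma energy_least_energy_ext: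
  assumes "least_energy_ext q (bottom_row_with_top q n) f u"
  shows "energy q u = ereal (form n (u (q 0)) (\<lambda>i. u (bottom_pt q n i)))"
proof -
  obtain v where v: "least_energy_ext q (bottom_row_with_top q n) f v"
      "energy q v = ereal (form n (f (q 0)) (\<lambda>i. f (bottom_pt q n i)))"
    using least_energy_ext_exists by blast
  have "energy q u = energy q v"
    using assms v(1) unfolding least_energy_ext_def by (blast intro: antisym)
  moreover have "form n (f (q 0)) (\<lambda>i. f (bottom_pt q n i)) = form n (u (q 0)) (\<lambda>i. u (bottom_pt q n i))"
    using assms by (simp add: form_def bottom_row_with_top_def least_energy_ext_def)
  ultimately show ?thesis using v(2) by simp
qed

end

text \<open>Polarisation: evaluating the difference of the two forms at the indicators of
  \<open>x\<close>, of \<open>y\<close> and at their sum isolates the coefficient of the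
  pair.\<close>

lemma conductances_unique:
  fixes c d :: "'a \<Rightarrow> 'a \<Rightarrow> real"
  assumes A: "finite A" and xy: "x \<in> A" "y \<in> A" "x \<noteq> y"
    and c: "\<And>x y. c x y = c y x" and d: "\<And>x y. d x y = d y x"
    and eq: "\<And>f. (\<Sum>x\<in>A. \<Sum>y\<in>A. c x y * (f x - f y)^2) = (\<Sum>x\<in>A. \<Sum>y\<in>A. d x y * (f x - f y)^2)"
  shows "c x y = d x y"
proof -
  define B where "B f = (\<Sum>a\<in>A. \<Sum>b\<in>A. (c a b - d a b) * (f a - f b)^2)" for f :: "'a \<Rightarrow> real"
  have B: "B f = 0" for f
    using eq[of f] by (simp add: B_def left_diff_distrib sum_subtractf)
  let ?i = "\<lambda>z a. if a = z then 1 else 0 :: real"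
  have "(\<Sum>a\<in>A. \<Sum>b\<in>A. (c a b - d a b) * (?i x a * ?i y b)) = c x y - d x y"
    "(\<Sum>a\<in>A. \<Sum>b\<in>A. (c a b - d a b) * (?i y a * ?i x b)) = c y x - d y x"
    using A xy by (simp_all add: if_distrib[of "\<lambda>t. _ * t"] if_distribR cong: if_cong)
  moreover have "B (\<lambda>a. ?i x a + ?i y a) = B (?i x) + B (?i y)
      - 2 * (\<Sum>a\<in>A. \<Sum>b\<in>A. (c a b - d a b) * (?i x a * ?i y b))
      - 2 * (\<Sum>a\<in>A. \<Sum>b\<in>A. (c a b - d a b) * (?i y a * ?i x b))"
    unfolding B_def sum_distrib_left sum.distrib[symmetric] sum_subtractf[symmetric]
    using xy(3) by (intro sum.cong refl) (simp add: power2_eq_square)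
  ultimately show ?thesis using c[of x y] d[of x y] by (simp add: B)
qed

context equilateral_triangle
begin

lemma row_conductance_eq:
  assumes ij: "i \<le> 2^n" "j \<le> 2^n" "i \<noteq> j"
  shows "row_conductance q n i j = cond n i j"
proof -
  let ?A = "bottom_row_with_top q n" and ?b = "bottom_pt q n"
  have inj: "inj_on ?b S" for S by (simp add: inj_on_def bottom_pt_eq_iff)
  have fin: "finite ?A" by (simp add: bottom_row_with_top_def)
  define ix where "ix = inv_into {..2^n} ?b"
  have ix: "ix (?b k) = k" if "k \<le> 2^n" for k
    unfolding ix_def using inj that by (simp add: inv_into_f_f)
  \<comment> \<open>The coefficients are carried from indices to points of the plane, with the zeros
    that the definition of \<open>conductance\<close> prescribes.\<close>
  define c where "c x y = (if x = y \<or> x \<notin> ?A \<or> y \<notin> ?A then 0 else if x = q 0 then tau n (ix y)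
      else if y = q 0 then tau n (ix x) else cond n (ix x) (ix y))" for x y
  have c_comm: "c x y = c y x" for x y
    by (auto simp: c_def cond_commute)
  have c_top: "c (q 0) (?b k) = tau n k" "c (?b k) (q 0) = tau n k" if "k \<le> 2^n" for k
    using that bottom_pt_neq_top[of n k] by (auto simp: c_def ix bottom_row_with_top_def)
  have c_row: "c (?b k) (?b l) = cond n k l" if "k \<le> 2^n" "l \<le> 2^n" "k \<noteq> l" for k l
    using that bottom_pt_neq_top[of n k] bottom_pt_neq_top[of n l]
    by (auto simp: c_def ix bottom_row_with_top_def bottom_pt_eq_iff)
  have sum_A: "(\<Sum>x\<in>?A. h x) = h (q 0) + (\<Sum>k\<le>2^n. h (?b k))" for h :: "real^2 \<Rightarrow> real"
  proof -
    have "q 0 \<notin> ?b ` {..2^n}" by (auto simp: bottom_pt_neq_top[symmetric])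
    then show ?thesis
      unfolding bottom_row_with_top_def by (simp add: sum.reindex[OF inj])
  qed
  have c_form: "(\<Sum>x\<in>?A. \<Sum>y\<in>?A. c x y * (u x - u y)^2) / 2
      = form n (u (q 0)) (\<lambda>i. u (?b i))" for u
  proof -
    have "(\<Sum>k\<le>2^n. c (q 0) (?b k) * (u (q 0) - u (?b k))^2) = (\<Sum>k\<le>2^n. tau n k * (u (q 0) - u (?b k))^2)"
      "(\<Sum>k\<le>2^n. c (?b k) (q 0) * (u (?b k) - u (q 0))^2) = (\<Sum>k\<le>2^n. tau n k * (u (q 0) - u (?b k))^2)"
      by (auto intro!: sum.cong simp: c_top power2_commute)
    moreover have "(\<Sum>k\<le>2^n. \<Sum>l\<le>2^n. c (?b k) (?b l) * (u (?b k) - u (?b l))^2)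
        = (\<Sum>k\<le>2^n. \<Sum>l\<le>2^n. cond n k l * (u (?b k) - u (?b l))^2)"
    proof (intro sum.cong refl)
      fix k l :: nat assume "k \<in> {..2^n}" "l \<in> {..2^n}"
      then show "c (?b k) (?b l) * (u (?b k) - u (?b l))^2 = cond n k l * (u (?b k) - u (?b l))^2"
        by (cases "k = l") (auto simp: c_row)
    qed
    ultimately show ?thesis
      unfolding sum_A sum.distrib form_def by simp
  qed
  have "conductance q ?A = c"
    unfolding conductance_def
  proof (rule the_equality)
    show "(\<forall>x y. c x y = c y x) \<and> (\<forall>x y. x = y \<or> x \<notin> ?A \<or> y \<notin> ?A \<longrightarrow> c x y = 0) \<and>
      (\<forall>f u. least_energy_ext q ?A f u \<longrightarrow>
        energy q u = ereal ((\<Sum>x\<in>?A. \<Sum>y\<in>?A. c x y * (u x - u y)^2) / 2))"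
      using c_comm energy_least_energy_ext unfolding c_form by (auto simp: c_def)
  next
    fix d assume d: "(\<forall>x y. d x y = d y x) \<and> (\<forall>x y. x = y \<or> x \<notin> ?A \<or> y \<notin> ?A \<longrightarrow> d x y = 0) \<and>
      (\<forall>f u. least_energy_ext q ?A f u \<longrightarrow>
        energy q u = ereal ((\<Sum>x\<in>?A. \<Sum>y\<in>?A. d x y * (u x - u y)^2) / 2))"
    \<comment> \<open>Every \<open>f\<close> is admissible boundary data, so the energy formula for
      minimisers becomes an identity of quadratic forms.\<close>
    have eq: "(\<Sum>x\<in>?A. \<Sum>y\<in>?A. d x y * (f x - f y)^2) = (\<Sum>x\<in>?A. \<Sum>y\<in>?A. c x y * (f x - f y)^2)" for f
    proof -
      obtain u where u: "least_energy_ext q ?A f u"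
        using least_energy_ext_exists by blast
      then have uf: "u x = f x" if "x \<in> ?A" for x using that by (simp add: least_energy_ext_def)
      have "energy q u = ereal ((\<Sum>x\<in>?A. \<Sum>y\<in>?A. d x y * (u x - u y)^2) / 2)" using d u by blast
      then have "(\<Sum>x\<in>?A. \<Sum>y\<in>?A. d x y * (u x - u y)^2) = (\<Sum>x\<in>?A. \<Sum>y\<in>?A. c x y * (u x - u y)^2)"
        using energy_least_energy_ext[OF u] unfolding c_form[symmetric] by simp
      then show ?thesis by (simp add: uf)
    qed
    have "d x y = c x y" for x y
    proof (cases "x = y \<or> x \<notin> ?A \<or> y \<notin> ?A")
      case True
      then show ?thesis using d by (auto simp: c_def)
    next
      case False
      then show ?thesis using conductances_unique[OF fin _ _ _ _ c_comm eq, of x y] d by blast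
    qed
    then show "d = c" by blast
  qed
  then show ?thesis
    unfolding row_conductance_def using c_row[OF ij] by simp
qed

end

section \<open>The explicit increment for interior points of the left half\<close>

lemma cond_Suc_left:
  assumes "0 < i" "i < j" "j < 2^n"
  shows "cond (Suc n) i j = 5/3 * cond n i j
    + 5/3 * ((tot n + 2) / ((tot n + 1) * (tot n + 3)) * (tot n / 2^n)^2)"
  \<comment> \<open>Both indices lie strictly inside the left half: all \<open>hi\<close> terms
    vanish, and \<open>tau n\<close> equals \<open>tot n / 2^n\<close> at both.\<close>
  using assms by (simp add: lo_def hi_def tau_def power2_eq_square algebra_simps)

lemma increment_eq:
  "5/3 * ((tot n + 2) / ((tot n + 1) * (tot n + 3)) * (tot n / 2^n)^2)
    = 196 * 25^(n+1) * (10 * 3^(n+1) + 39 * 10^(n+1)) /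
      ((3^(n+1) + 6 * 10^(n+1)) * (5 * 3^(n+1) + 16 * 10^(n+1)) * (5 * 3^(n+1) + 9 * 10^(n+1)))"
proof -
  define a b :: real where "a = 3^n" and "b = 10^n"
  have pos: "a > 0" "b > 0" by (simp_all add: a_def b_def)
  define D where "D = a + 6 * b"
  have D: "D > 0" "a + 20 * b > 0" "3 * a + 32 * b > 0" using pos by (simp_all add: D_def)
  have t: "tot n = 14 * b / D" by (simp add: tot_def a_def b_def D_def)
  have t123: "tot n + 1 = (a + 20 * b) / D" "tot n + 2 = (2 * a + 26 * b) / D"
      "tot n + 3 = (3 * a + 32 * b) / D"
    using D by (simp_all add: t D_def field_simps)
  have "(tot n / 2^n)^2 = 196 * 25^n / D^2"
  proof -
    have "b^2 = 25^n * (2^n)^2"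
      by (simp add: b_def power2_eq_square flip: power_mult_distrib)
    then show ?thesis by (simp add: t power_divide power_mult_distrib)
  qed
  then have "5/3 * ((tot n + 2) / ((tot n + 1) * (tot n + 3)) * (tot n / 2^n)^2)
    = 5/3 * ((2 * a + 26 * b) / D / ((a + 20 * b) / D * ((3 * a + 32 * b) / D)) * (196 * 25^n / D^2))"
    by (simp only: t123)
  also have "\<dots> = 196 * (25 * 25^n) * (10 * (3 * a) + 39 * (10 * b)) /
      ((3 * a + 6 * (10 * b)) * (5 * (3 * a) + 16 * (10 * b)) * (5 * (3 * a) + 9 * (10 * b)))"
  proof -
    \<comment> \<open>Up to constants, the factors of the closed form are the numerators of
      \<open>tot n + 1\<close>, \<open>tot n + 3\<close>, \<open>tot n + 2\<close> and the common
      denominator \<open>D\<close>.\<close>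
    have f: "3 * a + 6 * (10 * b) = 3 * (a + 20 * b)" "5 * (3 * a) + 16 * (10 * b) = 5 * (3 * a + 32 * b)"
      "5 * (3 * a) + 9 * (10 * b) = 15 * D" "10 * (3 * a) + 39 * (10 * b) = 15 * (2 * a + 26 * b)"
      by (simp_all add: D_def)
    have *: "5/3 * (X / D / (P / D * (Q / D)) * (196 * Y / D^2))
        = 196 * (25 * Y) * (15 * X) / (3 * P * (5 * Q) * (15 * D))"
      if "P > 0" "Q > 0" for X P Q Y :: real
      using that D(1) by (simp add: field_simps power2_eq_square)
    show ?thesis unfolding f by (rule *[OF D(2,3)])
  qed
  finally show ?thesis by (simp add: a_def b_def)
qed

theorem lemma2p21:
  fixes q :: "nat \<Rightarrow> real^2" and n i j :: nat
  assumes "equilateral q" and "n \<ge> 1" and "0 < i" and "i < j" and "j < 2^n"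
  shows "row_conductance q (n+1) i j =
    5/3 * row_conductance q n i j +
    196 * 25^(n+1) * (10 * 3^(n+1) + 39 * 10^(n+1)) /
      ((3^(n+1) + 6 * 10^(n+1)) * (5 * 3^(n+1) + 16 * 10^(n+1)) * (5 * 3^(n+1) + 9 * 10^(n+1)))"
proof -
  interpret equilateral_triangle q by unfold_locales (rule assms(1))
  have "row_conductance q n i j = cond n i j" "row_conductance q (n+1) i j = cond (Suc n) i j"
    using assms row_conductance_eq[of i n j] row_conductance_eq[of i "n+1" j] by simp_all
  then show ?thesis
    by (simp only: cond_Suc_left[OF assms(3-5)] increment_eq)
qed

end
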